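(* Let $q>0$ and let $y_1,\dots,y_M\in[0,1)$ be $q$-separated frequencies. Then the smallest singular value $\sigma_{\min}$ of the Vandermonde matrix $V_N(y_1,\dots,y_M)$ satisfies $$\sigma_{\min}^2\ \ge\ N+1-\frac1q .$$
   Context: For $y_1,\dots,y_M\in[0,1)$, $V_N(y_1,\dots,y_M)\in\mathbb{C}^{N\times M}$ is the matrix whose entry in row $k\in\{0,\dots,N-1\}$ and column $j\in\{1,\dots,M\}$ is $e^{2\pi i k y_j}$. The wrap-around distance is $|y-y'|_{\mathbb{T}}=\min_{k\in\mathbb{Z}}|y-y'-k|$. Frequencies $y_1,\dots,y_M$ are $q$-separated if $|y_j-y_l|_{\mathbb{T}}\ge q$ for all $j\ne l$.
   Formalization: For a single frequency (M=1) the claim is made only for q ≤ 1, since separation is then vacuous and σ_min² = N makes the bound false for every q > 1; M ≥ 1 is assumed so that σ_min exists. *)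

theory Defs
  imports
    "HOL-Analysis.Analysis"
    "Jordan_Normal_Form.Spectral_Radius"
    "Jordan_Normal_Form.Schur_Decomposition"
begin

text \<open>Rows and columns are indexed from 0, so the $M$ frequencies are \<open>y 0, \<dots>, y (M - 1)\<close>;
  values of \<open>y\<close> outside this range are irrelevant.\<close>

definition vandermonde :: "nat \<Rightarrow> nat \<Rightarrow> (nat \<Rightarrow> real) \<Rightarrow> complex mat" where
  "vandermonde N M y =
     mat N M (\<lambda>(k, j). exp (2 * complex_of_real pi * \<i> * of_nat k * complex_of_real (y j)))"

text \<open>The infimum is attained.\<close>

definition wrap_dist :: "real \<Rightarrow> real \<Rightarrow> real" where
  "wrap_dist x x' = (INF k::int. \<bar>x - x' - of_int k\<bar>)"

definition q_separated :: "real \<Rightarrow> nat \<Rightarrow> (nat \<Rightarrow> real) \<Rightarrow> bool" where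
  "q_separated q M y \<longleftrightarrow> (\<forall>j<M. \<forall>l<M. j \<noteq> l \<longrightarrow> wrap_dist (y j) (y l) \<ge> q)"

text \<open>A matrix with $M$ columns has $M$ singular values counted with multiplicity, namely the square
  roots of the eigenvalues of $A^* A$. In particular 0 is a singular value of every matrix with
  more columns than rows.\<close>

definition singular_values :: "complex mat \<Rightarrow> real set" where
  "singular_values A = {s. s \<ge> 0 \<and> eigenvalue (mat_adjoint A * A) (complex_of_real (s\<^sup>2))}"

definition sigma_min :: "complex mat \<Rightarrow> real" where
  "sigma_min A = Min (singular_values A)"

text \<open>For a matrix with at least one column, \<^const>\<open>sigma_min\<close> is a minimum over a finite nonempty
  set.\<close>

lemma finite_singular_values: "finite (singular_values A)"
proof -
  let ?B = "mat_adjoint A * A"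
  have B: "?B \<in> carrier_mat (dim_col A) (dim_col A)"
    by (auto simp: mat_adjoint_def)
  have "(\<lambda>s. complex_of_real (s\<^sup>2)) ` singular_values A \<subseteq> spectrum ?B"
    by (auto simp: singular_values_def spectrum_def)
  moreover have "finite (spectrum ?B)"
    using card_finite_spectrum[OF B] by simp
  moreover have "inj_on (\<lambda>s. complex_of_real (s\<^sup>2)) (singular_values A)"
    by (auto simp: inj_on_def singular_values_def simp del: of_real_power)
  ultimately show ?thesis
    by (meson finite_imageD finite_subset)
qed

lemma singular_values_nonempty:
  assumes "dim_col A > 0"
  shows "singular_values A \<noteq> {}"
proof -
  let ?n = "dim_row A" and ?m = "dim_col A"
  let ?B = "mat_adjoint A * A"
  have B: "?B \<in> carrier_mat ?m ?m"
    by (auto simp: mat_adjoint_def)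
  have "spectrum ?B \<noteq> {}"
    using spectrum_non_empty[OF B] assms by simp
  then obtain k v where ev: "eigenvector ?B v k"
    by (auto simp: spectrum_def eigenvalue_def)
  have v: "v \<in> carrier_vec ?m" "v \<noteq> 0\<^sub>v ?m" "?B *\<^sub>v v = k \<cdot>\<^sub>v v"
    using ev B by (auto simp: eigenvector_def)
  define a where "a = (\<Sum>i<?m. (cmod (v $ i))\<^sup>2)"
  define w where "w = A *\<^sub>v v"
  define b where "b = (\<Sum>i<?n. (cmod (w $ i))\<^sup>2)"
  have w_nth: "w $ r = (\<Sum>i<?m. A $$ (r, i) * v $ i)" if "r < ?n" for r
    using that v(1) unfolding w_def
    by (auto simp: scalar_prod_def atLeast0LessThan)
  have kv: "k * v $ i = (\<Sum>r<?n. cnj (A $$ (r, i)) * w $ r)" if "i < ?m" for i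
  proof -
    have "k * v $ i = (?B *\<^sub>v v) $ i"
      using v that by simp
    also have "?B *\<^sub>v v = mat_adjoint A *\<^sub>v w"
      unfolding w_def
      by (rule assoc_mult_mat_vec[of _ ?m ?n _ ?m]) (use v in \<open>auto simp: mat_adjoint_def\<close>)
    also have "\<dots> $ i = (\<Sum>r<?n. cnj (A $$ (r, i)) * w $ r)"
      using that
      by (auto simp: mat_adjoint_def scalar_prod_def atLeast0LessThan w_def mat_of_rows_row)
    finally show ?thesis .
  qed
  have "k * of_real a = (\<Sum>i<?m. k * v $ i * cnj (v $ i))"
    by (simp add: a_def sum_distrib_left complex_norm_square mult.assoc del: of_real_power)
  also have "\<dots> = (\<Sum>i<?m. \<Sum>r<?n. cnj (A $$ (r, i)) * w $ r * cnj (v $ i))"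
    by (simp add: kv sum_distrib_right)
  also have "\<dots> = (\<Sum>r<?n. \<Sum>i<?m. cnj (A $$ (r, i)) * w $ r * cnj (v $ i))"
    by (rule sum.swap)
  also have "\<dots> = (\<Sum>r<?n. w $ r * cnj (\<Sum>i<?m. A $$ (r, i) * v $ i))"
    by (simp add: sum_distrib_left mult_ac)
  also have "\<dots> = (\<Sum>r<?n. w $ r * cnj (w $ r))"
    by (rule sum.cong) (auto simp: w_nth)
  also have "\<dots> = of_real b"
    by (simp add: b_def complex_norm_square del: of_real_power)
  finally have kab: "k * of_real a = of_real b" .
  obtain i where i: "i < ?m" "v $ i \<noteq> 0"
    using v(1,2) by (metis carrier_vecD eq_vecI index_zero_vec)
  have "a > 0"
    unfolding a_def by (rule sum_pos2[of _ i]) (use i in auto)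
  moreover have "b \<ge> 0"
    unfolding b_def by (simp add: sum_nonneg)
  ultimately have "k = of_real (b / a)" "b / a \<ge> 0"
    using kab by (auto simp: field_simps)
  hence "k = complex_of_real ((sqrt (b / a))\<^sup>2)"
    by simp
  moreover have "eigenvalue ?B k"
    using ev by (auto simp: eigenvalue_def)
  ultimately have "sqrt (b / a) \<in> singular_values A"
    using \<open>b / a \<ge> 0\<close> by (simp add: singular_values_def del: of_real_power)
  thus ?thesis by blast
qed

text \<open>For two or more frequencies, separation forces $q \le 1/2$.\<close>

lemma q_separated_imp_le_half:
  assumes "q_separated q M y" "M \<ge> 2"
  shows "q \<le> 1/2"
proof -
  have "q \<le> wrap_dist (y 0) (y 1)"
    using assms by (simp add: q_separated_def)
  also have "\<dots> \<le> \<bar>y 0 - y 1 - of_int (round (y 0 - y 1))\<bar>"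
    unfolding wrap_dist_def by (rule cINF_lower) (auto intro: bdd_belowI[of _ 0])
  also have "\<dots> \<le> 1/2"
    using of_int_round_abs_le[of "y 0 - y 1"] by (simp add: abs_minus_commute)
  finally show ?thesis .
qed

end

theory Submission
  imports Defs
begin

text \<open>
  Since \<open>\<sigma>\<^sup>2\<close> is a value of $\|Vc\|^2 / \|c\|^2$, it suffices to bound
  $\sum_{l=1}^{N} |\sum_j c_j e^{2\pi i l y_j}|^2$ from below by
  $(N + 1 - 1/q) \|c\|^2$; moving the range of $l$ by one only changes the phases of the $c_j$.

  Expanding the square, the diagonal contributes $N \|c\|^2$. For $j \neq l$ the geometric series is
  a difference of two unimodular rank-one factors divided by $2i \sin \pi(y_j - y_l)$, so the
  off-diagonal part is half the difference of two values of the cosecant form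
  $\sum_{j \neq l} u_j \bar u_l / \sin \pi(y_j - y_l)$. The inequality of Montgomery and Vaughan
  (\<open>Montgomery_Vaughan_cosecant\<close>) bounds that form by $\|u\|^2 / q$, which gives the
  lower bound $N - 1/q$ (\<open>dual_large_sieve_lower_bound\<close>).

  Their inequality is proved on an extremal eigenvector of the Hermitian matrix
  $(i / \sin \pi(y_j - y_l))$. The addition formula turns a product of two cosecants into a
  cosecant times a difference of cotangents; on an eigenvector the cotangent sums cancel, and what
  remains is dominated by a positive kernel that is at most $3/(\pi t)^2$ at distance $t$. Separation
  and $\sum 1/n^2 = \pi^2/6$ on both sides of each point then give exactly $1/q^2$.

  The missing $+1$ comes from a device of P. Cohen
  (\<open>dual_large_sieve_sharp_lower_bound\<close>): replace each $y_j$ by the $K$ points $(y_j + m)/K$,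
  which are $q/K$-separated. Summing over $m$ kills every frequency not divisible by $K$, so the range
  $1, \dots, K(N+1) - 1$ still only sees the $N$ multiples $K, \dots, KN$, although it is almost
  $K(N + 1)$ long. After division by $K^2$ the previous bound becomes $N + 1 - 1/K - 1/q$, and $K$
  tends to infinity.
\<close>

section \<open>The cosecant kernel on separated points\<close>

text \<open>
  The Taylor bounds $\sin x \ge x - x^3/6$ and $\cos x \le 1 - x^2/2 + x^4/24$ are enough, because
  $x^2 (1 + 2(1 - x^2/2 + x^4/24))$ is exactly $3 (x - x^3/6)^2$. The constant 3 is the value of
  the numerator at 0, and it makes the final constant in the cosecant inequality sharp.
\<close>

lemma csc_kernel_le_inverse_square:
  fixes x :: real
  assumes "x \<noteq> 0" "\<bar>x\<bar> \<le> pi / 2"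
  shows "(1 + 2 * \<bar>cos x\<bar>) / (sin x)\<^sup>2 \<le> 3 / x\<^sup>2"
proof -
  define z where "z = \<bar>x\<bar>"
  have z: "0 < z" "z \<le> pi / 2"
    using assms by (auto simp: z_def)
  have even: "\<bar>cos x\<bar> = cos z" "(sin x)\<^sup>2 = (sin z)\<^sup>2" "x\<^sup>2 = z\<^sup>2"
  proof -
    show "\<bar>cos x\<bar> = cos z"
      using z cos_ge_zero[of z] unfolding z_def by (cases "x \<ge> 0") auto
  qed (auto simp: z_def abs_if)
  have sin_pos: "sin z > 0"
    using z pi_gt_zero by (intro sin_gt_zero) auto
  obtain t where t: "0 < t" "t < z"
    "sin z = (\<Sum>m<5. sin_coeff m * z ^ m) + sin (t + 1/2 * real 5 * pi) / fact 5 * z ^ 5"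
    using Maclaurin_sin_expansion3[of 5 z] z by auto
  have "(\<Sum>m<5. sin_coeff m * z ^ m) = z - z ^ 3 / 6"
    by (simp add: lessThan_nat_numeral lessThan_Suc sin_coeff_def fact_numeral)
  moreover have "sin (t + 1/2 * real 5 * pi) = cos t"
  proof -
    have "t + 1/2 * real 5 * pi = t + pi / 2 + 2 * pi" by simp
    thus ?thesis by (simp only: sin_periodic) (simp add: sin_add)
  qed
  moreover have "cos t \<ge> 0"
    using t z by (intro cos_ge_zero) auto
  ultimately have sin_lower: "sin z \<ge> z - z ^ 3 / 6"
    using t z by simp
  obtain s where s: "0 < s" "s < z"
    "cos z = (\<Sum>m<6. cos_coeff m * z ^ m) + cos (s + 1/2 * real 6 * pi) / fact 6 * z ^ 6"
    using Maclaurin_cos_expansion2[of z 6] z by auto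
  have "(\<Sum>m<6. cos_coeff m * z ^ m) = 1 - z\<^sup>2 / 2 + z ^ 4 / 24"
    by (simp add: lessThan_nat_numeral lessThan_Suc cos_coeff_def fact_numeral)
  moreover have "cos (s + 1/2 * real 6 * pi) = - cos s"
  proof -
    have "s + 1/2 * real 6 * pi = s + pi + 2 * pi" by simp
    thus ?thesis by (simp only: cos_periodic) simp
  qed
  moreover have "cos s \<ge> 0"
    using s z by (intro cos_ge_zero) auto
  ultimately have cos_upper: "cos z \<le> 1 - z\<^sup>2 / 2 + z ^ 4 / 24"
    using s z by simp
  have "z \<le> 2"
    using z pi_less_4 by simp
  hence "z * z \<le> 2 * 2"
    using z by (intro mult_mono) auto
  hence "0 \<le> z * (1 - z * z / 6)"
    using z by simp
  hence "0 \<le> z - z ^ 3 / 6"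
    by (simp add: power3_eq_cube algebra_simps)
  hence "(z - z ^ 3 / 6)\<^sup>2 \<le> (sin z)\<^sup>2"
    using sin_lower by (intro power_mono)
  moreover have "z\<^sup>2 * (1 + 2 * cos z) \<le> z\<^sup>2 * (1 + 2 * (1 - z\<^sup>2 / 2 + z ^ 4 / 24))"
    using cos_upper by (intro mult_left_mono) auto
  moreover have "z\<^sup>2 * (1 + 2 * (1 - z\<^sup>2 / 2 + z ^ 4 / 24)) = 3 * (z - z ^ 3 / 6)\<^sup>2"
    by (simp add: power2_eq_square power3_eq_cube power4_eq_xxxx field_simps)
  ultimately have "z\<^sup>2 * (1 + 2 * cos z) \<le> 3 * (sin z)\<^sup>2"
    by linarith
  thus ?thesis
    using z sin_pos by (simp add: even divide_simps mult_ac)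
qed

text \<open>
  Rounding $d_j/\delta$ down sends the points injectively to positive integers, so the sum
  is dominated by $\delta^{-2} \zeta(2)$.
\<close>

lemma sum_inverse_squares_separated_le:
  fixes d :: "'a \<Rightarrow> real"
  assumes "finite J" "\<delta> > 0"
    and ge: "\<And>j. j \<in> J \<Longrightarrow> \<delta> \<le> d j"
    and sep: "\<And>i j. i \<in> J \<Longrightarrow> j \<in> J \<Longrightarrow> i \<noteq> j \<Longrightarrow> \<delta> \<le> \<bar>d i - d j\<bar>"
  shows "(\<Sum>j\<in>J. 1 / (d j)\<^sup>2) \<le> pi\<^sup>2 / (6 * \<delta>\<^sup>2)"
proof -
  define f where "f j = nat (\<lfloor>d j / \<delta>\<rfloor> - 1)" for j
  have floor_ge: "\<lfloor>d j / \<delta>\<rfloor> \<ge> 1" if "j \<in> J" for j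
    using ge[OF that] assms(2) by (simp add: le_floor_iff)
  have f: "real (f j) + 1 = of_int \<lfloor>d j / \<delta>\<rfloor>" if "j \<in> J" for j
  proof -
    have "real (f j) = of_int (\<lfloor>d j / \<delta>\<rfloor> - 1)"
      unfolding f_def using floor_ge[OF that] by (intro of_nat_nat) linarith
    thus ?thesis by simp
  qed
  have f_le: "\<delta> * (real (f j) + 1) \<le> d j" if "j \<in> J" for j
  proof -
    have "real (f j) + 1 \<le> d j / \<delta>"
      unfolding f[OF that] by (rule of_int_floor_le)
    thus ?thesis using assms(2) by (simp add: field_simps)
  qed
  have f_gt: "d j < \<delta> * (real (f j) + 2)" if "j \<in> J" for j
  proof -
    have "d j / \<delta> < real (f j) + 2"
      using f[OF that] real_of_int_floor_add_one_gt[of "d j / \<delta>"] by linarith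
    thus ?thesis using assms(2) by (simp add: field_simps)
  qed
  have inj: "inj_on f J"
  proof (rule inj_onI, rule ccontr)
    fix i j assume ij: "i \<in> J" "j \<in> J" "f i = f j" "i \<noteq> j"
    have "\<bar>d i - d j\<bar> < \<delta>"
      using f_le[OF ij(1)] f_le[OF ij(2)] f_gt[OF ij(1)] f_gt[OF ij(2)] ij(3)
      by (simp add: algebra_simps)
    thus False using sep[OF ij(1,2,4)] by simp
  qed
  have "(\<Sum>j\<in>J. 1 / (d j)\<^sup>2) \<le> (\<Sum>j\<in>J. 1 / (\<delta> * (real (f j) + 1))\<^sup>2)"
  proof (rule sum_mono)
    fix j assume "j \<in> J"
    have "0 < \<delta> * (real (f j) + 1)" using assms(2) by (simp add: add_nonneg_pos)
    thus "1 / (d j)\<^sup>2 \<le> 1 / (\<delta> * (real (f j) + 1))\<^sup>2"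
      using f_le[OF \<open>j \<in> J\<close>] by (intro divide_left_mono power_mono mult_pos_pos) auto
  qed
  also have "\<dots> = (\<Sum>j\<in>J. 1 / (real (f j) + 1)\<^sup>2) / \<delta>\<^sup>2"
    by (simp add: sum_divide_distrib power_mult_distrib mult_ac)
  also have "(\<Sum>j\<in>J. 1 / (real (f j) + 1)\<^sup>2) = (\<Sum>n\<in>f ` J. 1 / (real n + 1)\<^sup>2)"
    by (simp add: sum.reindex[OF inj])
  also have "\<dots> \<le> (\<Sum>n. 1 / (real n + 1)\<^sup>2)"
    using inverse_squares_sums assms(1)
    by (intro sum_le_suminf) (auto simp: sums_iff add_ac)
  also have "\<dots> = pi\<^sup>2 / 6"
    using inverse_squares_sums by (simp add: sums_iff add_ac)
  finally show ?thesis
    by (simp add: divide_right_mono)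
qed

text \<open>
  Quantifying over integer translates avoids the infimum in \<^const>\<open>wrap_dist\<close>, and the index set
  is arbitrary because the points \<open>(y j + m) / K\<close> are indexed by pairs.
\<close>

definition separated_mod_1 :: "real \<Rightarrow> 'a set \<Rightarrow> ('a \<Rightarrow> real) \<Rightarrow> bool" where
  "separated_mod_1 \<delta> I x \<longleftrightarrow>
     (\<forall>i\<in>I. \<forall>j\<in>I. i \<noteq> j \<longrightarrow> (\<forall>k::int. \<delta> \<le> \<bar>x i - x j - of_int k\<bar>))"

text \<open>
  Both sine and cosine change at most by a sign under integer translation, so distances can be
  reduced to $[-1/2, 1/2]$.
\<close>

lemma csc_kernel_shift:
  "(1 + 2 * \<bar>cos (pi * (t - of_int n))\<bar>) / (sin (pi * (t - of_int n)))\<^sup>2 =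
   (1 + 2 * \<bar>cos (pi * t)\<bar>) / (sin (pi * t))\<^sup>2"
proof -
  have "\<bar>sin (pi * (t - of_int n))\<bar> = \<bar>sin (pi * t)\<bar>" "\<bar>cos (pi * (t - of_int n))\<bar> = \<bar>cos (pi * t)\<bar>"
    by (cases "even n"; simp add: right_diff_distrib sin_diff cos_diff)+
  thus ?thesis by (metis power2_abs)
qed

text \<open>
  After reduction mod 1 the other points lie on the two sides of \<open>x s\<close>, each side being a separated
  set at distance at least $\delta$. Each side contributes
  $\frac{3}{\pi^2} \cdot \frac{\pi^2}{6 \delta^2} = \frac{1}{2\delta^2}$. The term
  \<open>t = s\<close> vanishes because it is a division by \<open>sin 0\<close>.
\<close>

lemma sum_csc_kernel_le:
  assumes "finite I" "\<delta> > 0" and sep: "separated_mod_1 \<delta> I x" and "s \<in> I"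
  shows "(\<Sum>t\<in>I. (1 + 2 * \<bar>cos (pi * (x s - x t))\<bar>) / (sin (pi * (x s - x t)))\<^sup>2) \<le> 1 / \<delta>\<^sup>2"
proof -
  let ?k = "\<lambda>t. (1 + 2 * \<bar>cos (pi * t)\<bar>) / (sin (pi * t))\<^sup>2"
  define d where "d t = x s - x t - of_int (round (x s - x t))" for t
  define P where "P = {t \<in> I - {s}. d t > 0}"
  define Q where "Q = {t \<in> I - {s}. d t < 0}"
  have d_half: "\<bar>d t\<bar> \<le> 1/2" for t
    using of_int_round_abs_le[of "x s - x t"] by (simp add: d_def abs_minus_commute)
  have d_ge: "\<delta> \<le> \<bar>d t\<bar>" if "t \<in> I - {s}" for t
    using sep[unfolded separated_mod_1_def, rule_format, of s t "round (x s - x t)"] that \<open>s \<in> I\<close>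
    by (auto simp: d_def)
  have d_sep: "\<delta> \<le> \<bar>d i - d j\<bar>" if "i \<in> I" "j \<in> I" "i \<noteq> j" for i j
  proof -
    have "d i - d j = x j - x i - of_int (round (x s - x i) - round (x s - x j))"
      by (simp add: d_def)
    thus ?thesis
      using sep[unfolded separated_mod_1_def, rule_format, of j i
          "round (x s - x i) - round (x s - x j)"] that by auto
  qed
  have "d t \<noteq> 0" if "t \<in> I - {s}" for t
    using d_ge[OF that] \<open>\<delta> > 0\<close> by auto
  hence split: "I - {s} = P \<union> Q" "P \<inter> Q = {}" "finite P" "finite Q"
    using assms(1) by (auto simp: P_def Q_def not_less_iff_gr_or_eq dest: less_asym)
  have k_le: "?k (x s - x t) \<le> 3 / pi\<^sup>2 * (1 / (d t)\<^sup>2)" if "t \<in> I - {s}" for t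
  proof -
    have "?k (x s - x t) = ?k (d t)"
      unfolding d_def by (rule csc_kernel_shift[symmetric])
    also have "\<dots> \<le> 3 / (pi * d t)\<^sup>2"
    proof (rule csc_kernel_le_inverse_square)
      show "pi * d t \<noteq> 0" using d_ge[OF that] \<open>\<delta> > 0\<close> by auto
      show "\<bar>pi * d t\<bar> \<le> pi / 2"
        using d_half[of t] by (simp add: abs_mult)
    qed
    finally show ?thesis by (simp add: power_mult_distrib)
  qed
  have "(\<Sum>t\<in>I. ?k (x s - x t)) = (\<Sum>t\<in>I - {s}. ?k (x s - x t))"
    using assms(1) \<open>s \<in> I\<close> by (subst sum.remove[of I s]) auto
  also have "\<dots> \<le> (\<Sum>t\<in>I - {s}. 3 / pi\<^sup>2 * (1 / (d t)\<^sup>2))"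
    by (rule sum_mono) (rule k_le)
  also have "\<dots> = 3 / pi\<^sup>2 * ((\<Sum>t\<in>P. 1 / (d t)\<^sup>2) + (\<Sum>t\<in>Q. 1 / (- d t)\<^sup>2))"
    unfolding split(1) sum_distrib_left[symmetric] using split by (simp add: sum.union_disjoint)
  also have "\<dots> \<le> 3 / pi\<^sup>2 * (pi\<^sup>2 / (6 * \<delta>\<^sup>2) + pi\<^sup>2 / (6 * \<delta>\<^sup>2))"
  proof (intro mult_left_mono add_mono sum_inverse_squares_separated_le)
    fix i j assume "i \<in> Q" "j \<in> Q" "i \<noteq> j"
    thus "\<delta> \<le> \<bar>- d i - - d j\<bar>" using d_sep[of i j] by (simp add: Q_def abs_minus_commute)
  next
    fix i j assume "i \<in> P" "j \<in> P" "i \<noteq> j"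
    thus "\<delta> \<le> \<bar>d i - d j\<bar>" using d_sep[of i j] by (simp add: P_def)
  next
    fix j assume "j \<in> P"
    thus "\<delta> \<le> d j" using d_ge[of j] by (simp add: P_def)
  next
    fix j assume "j \<in> Q"
    thus "\<delta> \<le> - d j" using d_ge[of j] by (simp add: Q_def)
  qed (use assms(2) split in auto)
  also have "\<dots> = 1 / \<delta>\<^sup>2"
    using \<open>\<delta> > 0\<close> by (simp add: field_simps)
  finally show ?thesis .
qed

section \<open>Extremal eigenvectors of Hermitian forms\<close>

text \<open>
  Vectors over a finite index set are functions vanishing outside it, with the product topology; the
  sphere is then a closed subset of a product of compact sets.
\<close>

lemma compact_unit_sphere_finite_support:
  assumes "finite I"
  shows "compact {u :: 'a \<Rightarrow> complex. (\<forall>i. i \<notin> I \<longrightarrow> u i = 0) \<and> (\<Sum>i\<in>I. (cmod (u i))\<^sup>2) = 1}"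
    (is "compact ?S")
proof -
  define B :: "'a \<Rightarrow> complex set" where "B i = (if i \<in> I then cball 0 1 else {0})" for i
  have "compactin (product_topology (\<lambda>i. euclidean) UNIV) (PiE UNIV B)"
    by (subst compactin_PiE) (auto simp: B_def)
  hence "compact (PiE UNIV B)"
    by (simp add: euclidean_product_topology)
  moreover have "closed {u :: 'a \<Rightarrow> complex. (\<Sum>i\<in>I. (cmod (u i))\<^sup>2) = 1}"
    by (intro closed_Collect_eq continuous_intros continuous_on_product_coordinates)
  ultimately have "compact (PiE UNIV B \<inter> {u. (\<Sum>i\<in>I. (cmod (u i))\<^sup>2) = 1})"
    by (rule compact_Int_closed)
  also have "PiE UNIV B \<inter> {u. (\<Sum>i\<in>I. (cmod (u i))\<^sup>2) = 1} = ?S"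
  proof -
    have "cmod (u i) \<le> 1" if "(\<Sum>i\<in>I. (cmod (u i))\<^sup>2) = 1" "i \<in> I" for u i
    proof -
      have "(cmod (u i))\<^sup>2 \<le> 1"
        using member_le_sum[of i I "\<lambda>i. (cmod (u i))\<^sup>2"] that assms by auto
      thus ?thesis by (simp add: power2_le_iff_abs_le abs_square_le_1)
    qed
    thus ?thesis by (auto simp: B_def PiE_def split: if_splits)
  qed
  finally show ?thesis .
qed

lemma zero_of_linear_le_quadratic:
  fixes b c :: real
  assumes "\<And>t. t * b \<le> t\<^sup>2 * c"
  shows "b = 0"
proof (rule ccontr)
  assume "b \<noteq> 0"
  \<comment> \<open>At this \<open>t\<close> the linear term is twice the quadratic one with coefficient \<open>p > c\<close>.\<close>
  define p where "p = \<bar>c\<bar> + 1"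
  have p: "p > 0" "c \<le> p" by (auto simp: p_def)
  define t where "t = b / (2 * p)"
  have "t * b \<le> t\<^sup>2 * p"
    by (rule order.trans[OF assms mult_left_mono]) (use p in auto)
  hence "b\<^sup>2 \<le> 0"
    using p unfolding t_def by (simp add: power2_eq_square field_simps)
  thus False
    using \<open>b \<noteq> 0\<close> by simp
qed

text \<open>
  The Rayleigh quotient attains its maximum \<open>\<mu>\<close> at some unit vector \<open>v\<close>. The residual
  \<open>r = h v - \<mu> v\<close> is the direction of steepest ascent, so moving from \<open>v\<close> to \<open>v + t r\<close> changes
  \<open>\<langle>u, h u\<rangle> - \<mu> \<parallel>u\<parallel>\<^sup>2 \<le> 0\<close> by $2 t \|r\|^2$ to first order in $t$;
  maximality forces \<open>r = 0\<close>.
\<close>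

lemma hermitian_form_max_eigenvector:
  fixes h :: "'a \<Rightarrow> 'a \<Rightarrow> complex"
  assumes fin: "finite I" and ne: "I \<noteq> {}" and herm: "\<And>i j. h j i = cnj (h i j)"
  obtains v :: "'a \<Rightarrow> complex" and \<mu> :: real where
    "(\<Sum>i\<in>I. (cmod (v i))\<^sup>2) = 1"
    "\<And>i. i \<in> I \<Longrightarrow> (\<Sum>j\<in>I. h i j * v j) = \<mu> * v i"
    "\<And>u. Re (\<Sum>i\<in>I. \<Sum>j\<in>I. cnj (u i) * h i j * u j) \<le> \<mu> * (\<Sum>i\<in>I. (cmod (u i))\<^sup>2)"
proof -
  define H where "H u w = (\<Sum>i\<in>I. \<Sum>j\<in>I. cnj (u i) * h i j * w j)" for u w
  define n where "n u = (\<Sum>i\<in>I. (cmod (u i))\<^sup>2)" for u :: "'a \<Rightarrow> complex"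
  let ?S = "{u :: 'a \<Rightarrow> complex. (\<forall>i. i \<notin> I \<longrightarrow> u i = 0) \<and> n u = 1}"
  obtain i0 where i0: "i0 \<in> I" using ne by blast
  have "(\<lambda>i. if i = i0 then 1 else 0) \<in> ?S"
    using i0 fin by (auto simp: n_def if_distrib[of "\<lambda>z. (cmod z)\<^sup>2"] cong: if_cong)
  hence "?S \<noteq> {}" by (metis (no_types, lifting) emptyE)
  moreover have "compact ?S"
    unfolding n_def by (rule compact_unit_sphere_finite_support[OF fin])
  moreover have "continuous_on ?S (\<lambda>u. Re (H u u))"
    unfolding H_def
    by (intro continuous_intros continuous_on_product_coordinates[THEN continuous_on_subset]) auto
  ultimately obtain v where v: "v \<in> ?S" and max: "\<And>u. u \<in> ?S \<Longrightarrow> Re (H u u) \<le> Re (H v v)"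
    using continuous_attains_sup[of ?S "\<lambda>u. Re (H u u)"] by blast
  define \<mu> where "\<mu> = Re (H v v)"
  have bound: "Re (H u u) \<le> \<mu> * n u" for u
  proof (cases "n u = 0")
    case True
    hence "\<forall>i\<in>I. u i = 0"
      using fin by (simp add: n_def sum_nonneg_eq_0_iff)
    thus ?thesis by (simp add: H_def n_def)
  next
    case False
    hence pos: "n u > 0"
      using sum_nonneg[of I "\<lambda>i. (cmod (u i))\<^sup>2"] by (simp add: n_def)
    define c where "c = 1 / sqrt (n u)"
    have c2: "c * c = 1 / n u"
      using pos by (simp add: c_def)
    define w where "w i = (if i \<in> I then of_real c * u i else 0)" for i
    have "n w = c * c * n u"
      by (simp add: n_def w_def norm_mult power_mult_distrib power2_eq_square[of c]
          sum_distrib_left)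
    hence "w \<in> ?S" using c2 pos by (simp add: w_def)
    hence "Re (H w w) \<le> \<mu>" using max by (simp add: \<mu>_def)
    also have "H w w = of_real (c * c) * H u u"
      by (simp add: H_def w_def sum_distrib_left mult_ac)
    finally show ?thesis
      using c2 pos by (simp add: field_simps)
  qed
  define r where "r i = (\<Sum>j\<in>I. h i j * v j) - \<mu> * v i" for i
  define g where "g = (\<Sum>i\<in>I. Re (cnj (r i) * v i))"
  have Hrv: "Re (H r v) = n r + \<mu> * g"
  proof -
    have "H r v = (\<Sum>i\<in>I. cnj (r i) * (\<Sum>j\<in>I. h i j * v j))"
      by (simp add: H_def sum_distrib_left mult.assoc)
    also have "\<dots> = (\<Sum>i\<in>I. cnj (r i) * (r i + \<mu> * v i))"
      by (simp add: r_def)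
    also have "\<dots> = (\<Sum>i\<in>I. of_real ((cmod (r i))\<^sup>2) + \<mu> * (cnj (r i) * v i))"
      by (intro sum.cong refl) (simp add: complex_norm_square algebra_simps del: of_real_power)
    also have "\<dots> = of_real (n r) + of_real \<mu> * (\<Sum>i\<in>I. cnj (r i) * v i)"
      by (simp add: n_def sum.distrib sum_distrib_left del: of_real_power)
    finally show ?thesis
      by (simp add: g_def sum.distrib)
  qed
  have Hsym: "H v r = cnj (H r v)"
  proof -
    have "cnj (H r v) = (\<Sum>i\<in>I. \<Sum>j\<in>I. cnj (v j) * h j i * r i)"
      by (simp add: H_def herm[symmetric] mult_ac)
    also have "\<dots> = H v r"
      unfolding H_def by (rule sum.swap)
    finally show ?thesis ..
  qed
  have "t * (2 * n r) \<le> t\<^sup>2 * (\<mu> * n r - Re (H r r))" for t :: real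
  proof -
    define w where "w i = v i + t * r i" for i
    have "H w w = H v v + t * H r v + t * H v r + t\<^sup>2 * H r r"
      by (simp add: H_def w_def sum.distrib sum_distrib_left algebra_simps power2_eq_square)
    hence "Re (H w w) = \<mu> + 2 * t * Re (H r v) + t\<^sup>2 * Re (H r r)"
      by (simp add: Hsym \<mu>_def Re_complex_of_real flip: of_real_power)
    moreover have "n w = 1 + 2 * t * g + t\<^sup>2 * n r"
    proof -
      have "(cmod (w i))\<^sup>2 = (cmod (v i))\<^sup>2 + 2 * t * Re (cnj (r i) * v i) + t\<^sup>2 * (cmod (r i))\<^sup>2" for i
        unfolding w_def cmod_power2 by (simp add: algebra_simps power2_eq_square)
      hence "n w = n v + 2 * t * g + t\<^sup>2 * n r"
        by (simp only: n_def g_def sum.distrib sum_distrib_left)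
      thus ?thesis using v by simp
    qed
    ultimately show ?thesis
      using bound[of w] by (simp add: Hrv algebra_simps)
  qed
  hence "2 * n r = 0" by (rule zero_of_linear_le_quadratic)
  hence "\<forall>i\<in>I. r i = 0"
    using fin by (simp add: n_def sum_nonneg_eq_0_iff)
  thus ?thesis
    using that[of v \<mu>] v bound by (auto simp: r_def n_def H_def)
qed

section \<open>The cosecant inequality of Montgomery and Vaughan\<close>

lemma sin_cos_pi_diff_commute:
  "sin (pi * (t - s)) = - sin (pi * (s - t))" "cos (pi * (t - s)) = cos (pi * (s - t))"
proof -
  have "pi * (t - s) = - (pi * (s - t))" by (simp add: algebra_simps)
  thus "sin (pi * (t - s)) = - sin (pi * (s - t))" "cos (pi * (t - s)) = cos (pi * (s - t))"
    by (simp_all only: sin_minus cos_minus)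
qed

lemma sin_pi_diff_nonzero:
  assumes "separated_mod_1 \<delta> I x" "\<delta> > 0" "i \<in> I" "j \<in> I" "i \<noteq> j"
  shows "sin (pi * (x i - x j)) \<noteq> 0"
proof
  assume "sin (pi * (x i - x j)) = 0"
  then obtain n :: int where "x i - x j = of_int n"
    by (auto simp: sin_zero_iff_int2)
  thus False
    using assms(1)[unfolded separated_mod_1_def, rule_format, of i j n] assms by auto
qed

text \<open>This is the addition formula for $\sin((r - t) - (r - s))$, divided by the sines.\<close>

lemma csc_mult_csc:
  fixes r s t :: real
  assumes "sin (r - s) \<noteq> 0" "sin (r - t) \<noteq> 0" "sin (s - t) \<noteq> 0"
  shows "1 / sin (r - s) * (1 / sin (r - t)) =
    1 / sin (s - t) * (cos (r - s) / sin (r - s) - cos (r - t) / sin (r - t))"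
proof -
  have "sin (s - t) = sin ((r - t) - (r - s))" by simp
  also have "\<dots> = sin (r - t) * cos (r - s) - cos (r - t) * sin (r - s)"
    by (rule sin_diff)
  finally show ?thesis
    using assms by (simp add: field_simps)
qed

text \<open>
  The entries of the square of the cosecant matrix. For \<open>s \<noteq> t\<close>, summing \<open>csc_mult_csc\<close> over \<open>r\<close> gives
  complete cotangent sums that depend on \<open>s\<close> or on \<open>t\<close> alone. The terms \<open>r = s\<close> and \<open>r = t\<close>, where
  \<open>csc_mult_csc\<close> does not apply and the left-hand side is 0, account for \<open>2 * ct s t\<close>. Diagonal values of
  \<open>a\<close> and \<open>ct\<close> are 0 since they are divisions by \<open>sin 0\<close>.
\<close>

lemma sum_csc_mult_csc:
  fixes x :: "'a \<Rightarrow> real"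
  defines "a \<equiv> \<lambda>i j. 1 / sin (pi * (x i - x j))"
    and "ct \<equiv> \<lambda>i j. cos (pi * (x i - x j)) / sin (pi * (x i - x j))"
  assumes "finite I" "\<delta> > 0" and sep: "separated_mod_1 \<delta> I x" and "s \<in> I" "t \<in> I"
  shows "(\<Sum>r\<in>I. a r s * a r t) =
    (if s = t then \<Sum>r\<in>I. (a r s)\<^sup>2 else 0) +
    a s t * ((\<Sum>r\<in>I. ct r s) - (\<Sum>r\<in>I. ct r t) + 2 * ct s t)"
proof (cases "s = t")
  case True
  thus ?thesis by (simp add: a_def power2_eq_square)
next
  case False
  have "a r s * a r t = a s t * (ct r s - ct r t + (if r = s then ct s t else 0) +
      (if r = t then ct s t else 0))" if "r \<in> I" for r
  proof -
    have "ct t s = - ct s t"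
      by (simp add: ct_def sin_cos_pi_diff_commute[of "x t" "x s"])
    moreover have "a r s * a r t = a s t * (ct r s - ct r t)" if "r \<noteq> s" "r \<noteq> t"
      unfolding a_def ct_def right_diff_distrib[of pi]
      by (rule csc_mult_csc;
          use sin_pi_diff_nonzero[OF sep \<open>\<delta> > 0\<close>] assms that \<open>r \<in> I\<close> False in
            \<open>simp add: right_diff_distrib\<close>)
    ultimately show ?thesis
      using False by (auto simp: a_def ct_def)
  qed
  hence "(\<Sum>r\<in>I. a r s * a r t) = (\<Sum>r\<in>I. a s t * (ct r s - ct r t +
      (if r = s then ct s t else 0) + (if r = t then ct s t else 0)))"
    by (rule sum.cong[OF refl])
  also have "\<dots> = a s t * ((\<Sum>r\<in>I. ct r s) - (\<Sum>r\<in>I. ct r t) + 2 * ct s t)"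
    using \<open>finite I\<close> \<open>s \<in> I\<close> \<open>t \<in> I\<close>
    by (simp add: sum_distrib_left[symmetric] sum.distrib sum_subtractf)
  finally show ?thesis using False by simp
qed

text \<open>
  Expand $\mu^2 = \|A v\|^2$ with \<open>sum_csc_mult_csc\<close>. The terms with the cotangent sums \<open>C s\<close>
  and \<open>C t\<close> can be summed over the other index first; as \<open>v\<close> is an eigenvector and \<open>A\<close> is
  antisymmetric, both equal $i \mu \sum_s C_s |v_s|^2$ and cancel. The remaining off-diagonal part
  has symmetric coefficients, and $2 |v_s v_t| \le |v_s|^2 + |v_t|^2$ reduces it to row sums of
  the cosecant kernel.
\<close>

lemma csc_eigenvalue_bound:
  fixes x :: "'a \<Rightarrow> real" and \<mu> :: real and v :: "'a \<Rightarrow> complex"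
  assumes fin: "finite I" and "\<delta> > 0" and sep: "separated_mod_1 \<delta> I x"
    and norm: "(\<Sum>i\<in>I. (cmod (v i))\<^sup>2) = 1"
    and eig: "\<And>i. i \<in> I \<Longrightarrow>
      (\<Sum>j\<in>I. of_real (1 / sin (pi * (x i - x j))) * v j) = - (\<i> * of_real \<mu> * v i)"
  shows "\<mu> \<le> 1 / \<delta>"
proof -
  define a where "a i j = 1 / sin (pi * (x i - x j))" for i j
  define ct where "ct i j = cos (pi * (x i - x j)) / sin (pi * (x i - x j))" for i j
  define C where "C s = (\<Sum>r\<in>I. ct r s)" for s
  define D where "D s = (\<Sum>r\<in>I. (a r s)\<^sup>2)" for s
  define A where "A i = (\<Sum>j\<in>I. of_real (a i j) * v j)" for i
  define W where "W = (\<Sum>s\<in>I. \<Sum>t\<in>I. v s * cnj (v t) * of_real (a s t * ct s t))"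
  have anti: "a j i = - a i j" for i j
    by (simp add: a_def sin_cos_pi_diff_commute[of "x j" "x i"])
  have A: "A i = - (\<i> * of_real \<mu> * v i)" if "i \<in> I" for i
    using eig[OF that] by (simp add: A_def a_def)
  \<comment> \<open>\<open>T2\<close> and \<open>T3\<close> have the same right-hand side and occur with opposite signs below.\<close>
  have T2: "(\<Sum>s\<in>I. \<Sum>t\<in>I. v s * cnj (v t) * of_real (a s t * C s)) =
      (\<Sum>s\<in>I. \<i> * of_real (\<mu> * C s) * (v s * cnj (v s)))"
  proof (rule sum.cong[OF refl])
    fix s assume "s \<in> I"
    have "(\<Sum>t\<in>I. v s * cnj (v t) * of_real (a s t * C s)) = of_real (C s) * v s * cnj (A s)"
      by (simp add: A_def sum_distrib_left mult_ac)
    thus "(\<Sum>t\<in>I. v s * cnj (v t) * of_real (a s t * C s)) = \<i> * of_real (\<mu> * C s) * (v s * cnj (v s))"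
      by (simp add: A[OF \<open>s \<in> I\<close>] mult_ac)
  qed
  have T3: "(\<Sum>s\<in>I. \<Sum>t\<in>I. v s * cnj (v t) * of_real (a s t * C t)) =
      (\<Sum>t\<in>I. \<i> * of_real (\<mu> * C t) * (v t * cnj (v t)))"
  proof (subst sum.swap, rule sum.cong[OF refl])
    fix t assume "t \<in> I"
    have "(\<Sum>s\<in>I. v s * cnj (v t) * of_real (a s t * C t)) = - (of_real (C t) * cnj (v t) * A t)"
      by (simp add: A_def sum_distrib_left mult_ac anti[of _ t] flip: sum_negf)
    thus "(\<Sum>s\<in>I. v s * cnj (v t) * of_real (a s t * C t)) = \<i> * of_real (\<mu> * C t) * (v t * cnj (v t))"
      by (simp add: A[OF \<open>t \<in> I\<close>] mult_ac)
  qed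
  have "(\<Sum>r\<in>I. A r * cnj (A r)) =
      (\<Sum>r\<in>I. \<Sum>s\<in>I. \<Sum>t\<in>I. v s * cnj (v t) * of_real (a r s * a r t))"
    by (simp add: A_def sum_product mult_ac)
  also have "\<dots> = (\<Sum>s\<in>I. \<Sum>r\<in>I. \<Sum>t\<in>I. v s * cnj (v t) * of_real (a r s * a r t))"
    by (rule sum.swap)
  also have "\<dots> = (\<Sum>s\<in>I. \<Sum>t\<in>I. \<Sum>r\<in>I. v s * cnj (v t) * of_real (a r s * a r t))"
    by (rule sum.cong[OF refl], rule sum.swap)
  also have "\<dots> = (\<Sum>s\<in>I. \<Sum>t\<in>I. v s * cnj (v t) * of_real (\<Sum>r\<in>I. a r s * a r t))"
    by (simp add: sum_distrib_left)
  also have "\<dots> = (\<Sum>s\<in>I. \<Sum>t\<in>I. (if s = t then v s * cnj (v s) * of_real (D s) else 0) +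
      v s * cnj (v t) * of_real (a s t * C s) - v s * cnj (v t) * of_real (a s t * C t) +
      2 * (v s * cnj (v t) * of_real (a s t * ct s t)))"
  proof (intro sum.cong refl)
    fix s t assume st: "s \<in> I" "t \<in> I"
    have *: "(\<Sum>r\<in>I. a r s * a r t) = (if s = t then D s else 0) + a s t * (C s - C t + 2 * ct s t)"
      using sum_csc_mult_csc[OF fin \<open>\<delta> > 0\<close> sep st]
      by (simp only: a_def[abs_def] ct_def[abs_def] C_def[abs_def] D_def[abs_def])
    show "v s * cnj (v t) * of_real (\<Sum>r\<in>I. a r s * a r t) =
      (if s = t then v s * cnj (v s) * of_real (D s) else 0) +
      v s * cnj (v t) * of_real (a s t * C s) - v s * cnj (v t) * of_real (a s t * C t) +
      2 * (v s * cnj (v t) * of_real (a s t * ct s t))"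
      unfolding * by (simp add: algebra_simps)
  qed
  also have "\<dots> = (\<Sum>s\<in>I. v s * cnj (v s) * of_real (D s)) + 2 * W"
    using fin by (simp only: sum.distrib sum_subtractf T2 T3 W_def sum_distrib_left) simp
  finally have expand: "(\<Sum>r\<in>I. A r * cnj (A r)) = (\<Sum>s\<in>I. v s * cnj (v s) * of_real (D s)) + 2 * W" .
  have "complex_of_real (\<mu>\<^sup>2) = (\<Sum>r\<in>I. A r * cnj (A r))"
  proof -
    have "(\<Sum>r\<in>I. A r * cnj (A r)) = (\<Sum>r\<in>I. of_real (\<mu>\<^sup>2 * (cmod (v r))\<^sup>2))"
    proof (rule sum.cong[OF refl])
      fix r assume "r \<in> I"
      have "A r * cnj (A r) = of_real ((cmod (A r))\<^sup>2)"
        by (simp add: complex_norm_square del: of_real_power)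
      also have "(cmod (A r))\<^sup>2 = \<mu>\<^sup>2 * (cmod (v r))\<^sup>2"
        by (simp add: A[OF \<open>r \<in> I\<close>] norm_mult power_mult_distrib)
      finally show "A r * cnj (A r) = of_real (\<mu>\<^sup>2 * (cmod (v r))\<^sup>2)" .
    qed
    also have "\<dots> = of_real (\<mu>\<^sup>2 * (\<Sum>r\<in>I. (cmod (v r))\<^sup>2))"
      by (simp only: of_real_sum sum_distrib_left)
    finally show ?thesis by (simp add: norm)
  qed
  also note expand
  also have "(\<Sum>s\<in>I. v s * cnj (v s) * of_real (D s)) = of_real (\<Sum>s\<in>I. (cmod (v s))\<^sup>2 * D s)"
    by (simp add: complex_norm_square del: of_real_power)
  finally have "complex_of_real (\<mu>\<^sup>2) = of_real (\<Sum>s\<in>I. (cmod (v s))\<^sup>2 * D s) + 2 * W" .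
  hence "Re (complex_of_real (\<mu>\<^sup>2)) = Re (of_real (\<Sum>s\<in>I. (cmod (v s))\<^sup>2 * D s) + 2 * W)"
    by (rule arg_cong)
  hence "\<mu>\<^sup>2 = (\<Sum>s\<in>I. (cmod (v s))\<^sup>2 * D s) + 2 * Re W"
    by (simp del: of_real_power of_real_sum)
  also have "2 * Re W \<le> 2 * cmod W"
    using complex_Re_le_cmod[of W] by simp
  also have "\<dots> \<le> 2 * (\<Sum>s\<in>I. \<Sum>t\<in>I. cmod (v s * cnj (v t) * of_real (a s t * ct s t)))"
    unfolding W_def by (intro mult_left_mono order.trans[OF norm_sum] sum_mono norm_sum) auto
  also have "\<dots> \<le> (\<Sum>s\<in>I. \<Sum>t\<in>I. (cmod (v s))\<^sup>2 * \<bar>a s t * ct s t\<bar> + (cmod (v t))\<^sup>2 * \<bar>a s t * ct s t\<bar>)"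
    unfolding sum_distrib_left
  proof (intro sum_mono)
    fix s t
    have "2 * (cmod (v s) * cmod (v t)) \<le> (cmod (v s))\<^sup>2 + (cmod (v t))\<^sup>2"
      using sum_squares_bound[of "cmod (v s)" "cmod (v t)"] by simp
    hence "2 * (cmod (v s) * cmod (v t)) * \<bar>a s t * ct s t\<bar> \<le>
        ((cmod (v s))\<^sup>2 + (cmod (v t))\<^sup>2) * \<bar>a s t * ct s t\<bar>"
      by (rule mult_right_mono) simp
    thus "2 * cmod (v s * cnj (v t) * of_real (a s t * ct s t)) \<le>
        (cmod (v s))\<^sup>2 * \<bar>a s t * ct s t\<bar> + (cmod (v t))\<^sup>2 * \<bar>a s t * ct s t\<bar>"
      by (simp add: norm_mult algebra_simps del: of_real_mult)
  qed
  also have "\<dots> = (\<Sum>s\<in>I. (cmod (v s))\<^sup>2 * (\<Sum>t\<in>I. 2 * \<bar>a s t * ct s t\<bar>))"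
  proof -
    have "(\<Sum>s\<in>I. \<Sum>t\<in>I. (cmod (v t))\<^sup>2 * \<bar>a s t * ct s t\<bar>) =
        (\<Sum>t\<in>I. \<Sum>s\<in>I. (cmod (v t))\<^sup>2 * \<bar>a s t * ct s t\<bar>)"
      by (rule sum.swap)
    also have "\<dots> = (\<Sum>t\<in>I. \<Sum>s\<in>I. (cmod (v t))\<^sup>2 * \<bar>a t s * ct t s\<bar>)"
    proof -
      have "\<bar>a s t * ct s t\<bar> = \<bar>a t s * ct t s\<bar>" for s t
        by (simp add: a_def ct_def sin_cos_pi_diff_commute[of "x t" "x s"])
      thus ?thesis by simp
    qed
    finally show ?thesis
      by (simp add: sum.distrib sum_distrib_left mult_ac flip: mult_2)
  qed
  also have "(\<Sum>s\<in>I. (cmod (v s))\<^sup>2 * D s) + (\<Sum>s\<in>I. (cmod (v s))\<^sup>2 * (\<Sum>t\<in>I. 2 * \<bar>a s t * ct s t\<bar>)) =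
      (\<Sum>s\<in>I. (cmod (v s))\<^sup>2 *
        (\<Sum>t\<in>I. (1 + 2 * \<bar>cos (pi * (x s - x t))\<bar>) / (sin (pi * (x s - x t)))\<^sup>2))"
  proof -
    have "D s + (\<Sum>t\<in>I. 2 * \<bar>a s t * ct s t\<bar>) =
        (\<Sum>t\<in>I. (1 + 2 * \<bar>cos (pi * (x s - x t))\<bar>) / (sin (pi * (x s - x t)))\<^sup>2)" for s
      unfolding D_def sum.distrib[symmetric]
    proof (rule sum.cong[OF refl])
      fix t
      have "(a t s)\<^sup>2 = (a s t)\<^sup>2"
        by (simp add: anti[of s t])
      thus "(a t s)\<^sup>2 + 2 * \<bar>a s t * ct s t\<bar> =
          (1 + 2 * \<bar>cos (pi * (x s - x t))\<bar>) / (sin (pi * (x s - x t)))\<^sup>2"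
        by (simp add: a_def ct_def power2_eq_square abs_mult add_divide_distrib)
    qed
    thus ?thesis by (simp only: distrib_left[symmetric] sum.distrib[symmetric])
  qed
  also have "\<dots> \<le> (\<Sum>s\<in>I. (cmod (v s))\<^sup>2 * (1 / \<delta>\<^sup>2))"
    using sum_csc_kernel_le[OF fin \<open>\<delta> > 0\<close> sep] by (intro sum_mono mult_left_mono) auto
  also have "\<dots> = (1 / \<delta>)\<^sup>2"
    by (simp add: norm power_one_over flip: sum_distrib_right sum_divide_distrib)
  finally have "\<mu>\<^sup>2 \<le> (1 / \<delta>)\<^sup>2" by simp
  thus ?thesis
    by (rule power2_le_imp_le) (use \<open>\<delta> > 0\<close> in simp)
qed

text \<open>
  The form is purely imaginary because its matrix is real and antisymmetric, so its modulus is
  controlled by the largest eigenvalue of \<open>\<i> A\<close> alone: conjugating \<open>u\<close> changes the sign of the form.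
\<close>

theorem Montgomery_Vaughan_cosecant:
  fixes x :: "'a \<Rightarrow> real" and u :: "'a \<Rightarrow> complex"
  assumes fin: "finite I" and "\<delta> > 0" and sep: "separated_mod_1 \<delta> I x"
  shows "cmod (\<Sum>i\<in>I. \<Sum>j\<in>I. u i * cnj (u j) / of_real (sin (pi * (x i - x j)))) \<le>
    (\<Sum>i\<in>I. (cmod (u i))\<^sup>2) / \<delta>"
proof (cases "I = {}")
  case False
  define a where "a i j = 1 / sin (pi * (x i - x j))" for i j
  define F where "F u = (\<Sum>i\<in>I. \<Sum>j\<in>I. u i * cnj (u j) * of_real (a i j))" for u :: "'a \<Rightarrow> complex"
  have anti: "a j i = - a i j" for i j
    by (simp add: a_def sin_cos_pi_diff_commute[of "x j" "x i"])
  define h where "h i j = \<i> * of_real (a i j)" for i j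
  have herm: "h j i = cnj (h i j)" for i j
    by (simp add: h_def anti[of i j])
  obtain v and \<mu> :: real where v: "(\<Sum>i\<in>I. (cmod (v i))\<^sup>2) = 1"
    and eig: "\<And>i. i \<in> I \<Longrightarrow> (\<Sum>j\<in>I. h i j * v j) = of_real \<mu> * v i"
    and bound: "\<And>u. Re (\<Sum>i\<in>I. \<Sum>j\<in>I. cnj (u i) * h i j * u j) \<le>
      \<mu> * (\<Sum>i\<in>I. (cmod (u i))\<^sup>2)"
    by (rule hermitian_form_max_eigenvector[of I h, OF fin False herm]) (rule that)
  have "\<mu> \<le> 1 / \<delta>"
  proof (rule csc_eigenvalue_bound[OF fin \<open>\<delta> > 0\<close> sep v])
    fix i assume "i \<in> I"
    have "(\<Sum>j\<in>I. of_real (a i j) * v j) = - \<i> * (\<Sum>j\<in>I. h i j * v j)"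
      unfolding sum_distrib_left by (intro sum.cong refl) (simp add: h_def mult.assoc)
    thus "(\<Sum>j\<in>I. of_real (1 / sin (pi * (x i - x j))) * v j) = - (\<i> * of_real \<mu> * v i)"
      using eig[OF \<open>i \<in> I\<close>] by (simp add: a_def)
  qed
  have Im_le: "Im (F u) \<le> (\<Sum>i\<in>I. (cmod (u i))\<^sup>2) / \<delta>" for u
  proof -
    have "(\<Sum>i\<in>I. \<Sum>j\<in>I. cnj (u i) * h i j * u j) = \<i> * cnj (F u)"
      unfolding F_def cnj_sum sum_distrib_left
      by (intro sum.cong refl) (simp add: h_def)
    hence "Im (F u) \<le> \<mu> * (\<Sum>i\<in>I. (cmod (u i))\<^sup>2)"
      using bound[of u] by simp
    also have "\<dots> \<le> 1 / \<delta> * (\<Sum>i\<in>I. (cmod (u i))\<^sup>2)"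
      using \<open>\<mu> \<le> 1 / \<delta>\<close> by (intro mult_right_mono sum_nonneg) auto
    finally show ?thesis by simp
  qed
  have F_cnj: "F (\<lambda>i. cnj (u i)) = cnj (F u)"
    by (simp add: F_def)
  have "cnj (F u) = (\<Sum>j\<in>I. \<Sum>i\<in>I. cnj (u i) * u j * of_real (a i j))"
    unfolding F_def by (subst sum.swap) simp
  also have "\<dots> = - F u"
    unfolding F_def sum_negf[symmetric]
  proof (intro sum.cong refl)
    fix i j
    show "cnj (u j) * u i * of_real (a j i) = - (u i * cnj (u j) * of_real (a i j))"
      by (simp add: anti[of i j])
  qed
  finally have "cnj (F u) = - F u" .
  hence "Re (F u) = 0"
    by (auto simp: complex_eq_iff)
  hence "cmod (F u) = \<bar>Im (F u)\<bar>"
    by (simp add: cmod_eq_Im)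
  also have "\<dots> \<le> (\<Sum>i\<in>I. (cmod (u i))\<^sup>2) / \<delta>"
    using Im_le[of u] Im_le[of "\<lambda>i. cnj (u i)"] by (simp add: F_cnj abs_le_iff)
  finally show ?thesis
    by (simp add: F_def a_def)
qed auto

section \<open>Lower bounds for exponential sums over separated frequencies\<close>

lemma sum_cis_closed_form:
  assumes "sin (pi * t) \<noteq> 0"
  shows "(\<Sum>k=1..L. cis (2 * pi * real k * t)) =
    (cis ((2 * real L + 1) * pi * t) - cis (pi * t)) / (2 * \<i> * of_real (sin (pi * t)))"
proof -
  have sin: "2 * \<i> * of_real (sin (pi * t)) = cis (pi * t) - cis (- (pi * t))"
    by (simp add: complex_eq_iff)
  have "(\<Sum>k=1..L. cis (2 * pi * real k * t)) * (cis (pi * t) - cis (- (pi * t))) =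
      cis ((2 * real L + 1) * pi * t) - cis (pi * t)"
  proof (induction L)
    case (Suc L)
    have "cis (2 * pi * real (Suc L) * t) * (cis (pi * t) - cis (- (pi * t))) =
        cis ((2 * real (Suc L) + 1) * pi * t) - cis ((2 * real L + 1) * pi * t)"
      by (simp add: right_diff_distrib cis_mult algebra_simps)
    with Suc show ?case by (simp add: distrib_right)
  qed simp
  thus ?thesis
    using assms by (simp add: sin[symmetric] field_simps)
qed

text \<open>
  The two exponentials in \<open>sum_cis_closed_form\<close> factor through the differences \<open>x i - x j\<close>, so
  they can be absorbed into the coefficients as the unimodular twists \<open>w\<close> and \<open>w'\<close> of \<open>u\<close>. Each of the
  two resulting cosecant forms enters with weight 1/2.
\<close>

lemma dual_large_sieve_lower_bound:
  fixes x :: "'a \<Rightarrow> real" and u :: "'a \<Rightarrow> complex"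
  assumes fin: "finite I" and "\<delta> > 0" and sep: "separated_mod_1 \<delta> I x"
  shows "(real L - 1 / \<delta>) * (\<Sum>i\<in>I. (cmod (u i))\<^sup>2) \<le>
    (\<Sum>k=1..L. (cmod (\<Sum>i\<in>I. u i * cis (2 * pi * real k * x i)))\<^sup>2)"
proof -
  define n where "n = (\<Sum>i\<in>I. (cmod (u i))\<^sup>2)"
  define F where "F w = (\<Sum>i\<in>I. \<Sum>j\<in>I. w i * cnj (w j) / of_real (sin (pi * (x i - x j))))"
    for w :: "'a \<Rightarrow> complex"
  define w where "w i = u i * cis ((2 * real L + 1) * pi * x i)" for i
  define w' where "w' i = u i * cis (pi * x i)" for i
  define S where "S k = (\<Sum>i\<in>I. u i * cis (2 * pi * real k * x i))" for k
  have kernel: "u i * cnj (u j) * (\<Sum>k=1..L. cis (2 * pi * real k * (x i - x j))) =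
      (if i = j then of_real (real L * (cmod (u i))\<^sup>2) else 0) +
      (w i * cnj (w j) / of_real (sin (pi * (x i - x j))) - w' i * cnj (w' j) / of_real (sin (pi * (x i - x j)))) / (2 * \<i>)"
    if "i \<in> I" "j \<in> I" for i j
  proof (cases "i = j")
    case True
    thus ?thesis by (simp add: complex_norm_square del: of_real_power)
  next
    case False
    have "w i * cnj (w j) = u i * cnj (u j) * cis ((2 * real L + 1) * pi * (x i - x j))"
      by (simp add: w_def cis_cnj cis_mult algebra_simps)
    moreover have "w' i * cnj (w' j) = u i * cnj (u j) * cis (pi * (x i - x j))"
      by (simp add: w'_def cis_cnj cis_mult algebra_simps)
    moreover have "z * ((A - B) / (2 * \<i> * s)) = (z * A / s - z * B / s) / (2 * \<i>)"
      for z A B s :: complex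
      by (simp add: diff_divide_distrib right_diff_distrib mult_ac)
    ultimately show ?thesis
      unfolding sum_cis_closed_form[OF sin_pi_diff_nonzero[OF sep \<open>\<delta> > 0\<close> that False]]
      by (simp only: False if_False add_0_left)
  qed
  have "of_real (\<Sum>k=1..L. (cmod (S k))\<^sup>2) = (\<Sum>k=1..L. S k * cnj (S k))"
    by (simp add: complex_norm_square del: of_real_power)
  also have "\<dots> = (\<Sum>k=1..L. \<Sum>i\<in>I. \<Sum>j\<in>I. u i * cnj (u j) * cis (2 * pi * real k * (x i - x j)))"
  proof (rule sum.cong[OF refl])
    fix k
    show "S k * cnj (S k) =
        (\<Sum>i\<in>I. \<Sum>j\<in>I. u i * cnj (u j) * cis (2 * pi * real k * (x i - x j)))"
      unfolding S_def cnj_sum sum_product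
      by (intro sum.cong refl) (simp add: cis_cnj cis_mult mult_ac right_diff_distrib)
  qed
  also have "\<dots> = (\<Sum>i\<in>I. \<Sum>k=1..L. \<Sum>j\<in>I. u i * cnj (u j) * cis (2 * pi * real k * (x i - x j)))"
    by (rule sum.swap)
  also have "\<dots> = (\<Sum>i\<in>I. \<Sum>j\<in>I. \<Sum>k=1..L. u i * cnj (u j) * cis (2 * pi * real k * (x i - x j)))"
    by (rule sum.cong[OF refl], rule sum.swap)
  also have "\<dots> = (\<Sum>i\<in>I. \<Sum>j\<in>I. (if i = j then of_real (real L * (cmod (u i))\<^sup>2) else 0) +
      (w i * cnj (w j) / of_real (sin (pi * (x i - x j))) - w' i * cnj (w' j) / of_real (sin (pi * (x i - x j)))) / (2 * \<i>))"
    by (intro sum.cong refl) (simp only: kernel flip: sum_distrib_left)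
  also have "\<dots> = of_real (real L * n) + (F w - F w') / (2 * \<i>)"
    by (simp only: sum.distrib sum_divide_distrib[symmetric] sum_subtractf F_def)
      (simp add: n_def sum_distrib_left fin)
  finally have eq: "complex_of_real (\<Sum>k=1..L. (cmod (S k))\<^sup>2) =
      of_real (real L * n) + (F w - F w') / (2 * \<i>)" .
  have "(\<Sum>k=1..L. (cmod (S k))\<^sup>2) = Re (of_real (real L * n) + (F w - F w') / (2 * \<i>))"
    unfolding eq[symmetric] by (rule Re_complex_of_real[symmetric])
  also have "\<dots> = real L * n + Re ((F w - F w') / (2 * \<i>))"
    by (simp only: plus_complex.simps Re_complex_of_real)
  also have "\<dots> \<ge> real L * n - n / \<delta>"
  proof -
    have "\<bar>Re ((F w - F w') / (2 * \<i>))\<bar> \<le> cmod ((F w - F w') / (2 * \<i>))"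
      by (rule abs_Re_le_cmod)
    also have "\<dots> \<le> (cmod (F w) + cmod (F w')) / 2"
      using norm_triangle_ineq4[of "F w" "F w'"] by (simp add: norm_divide norm_mult)
    also have "\<dots> \<le> n / \<delta>"
    proof -
      have "(\<Sum>i\<in>I. (cmod (w i))\<^sup>2) = n" "(\<Sum>i\<in>I. (cmod (w' i))\<^sup>2) = n"
        by (simp_all add: n_def w_def w'_def norm_mult)
      hence "cmod (F w) \<le> n / \<delta>" "cmod (F w') \<le> n / \<delta>"
        using Montgomery_Vaughan_cosecant[OF assms, of w] Montgomery_Vaughan_cosecant[OF assms, of w']
        unfolding F_def[symmetric] by simp_all
      moreover have "(a + b) / 2 \<le> c" if "a \<le> c" "b \<le> c" for a b c :: real
        using that by simp
      ultimately show ?thesis by blast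
    qed
    finally show ?thesis by linarith
  qed
  finally show ?thesis
    by (simp add: n_def S_def left_diff_distrib)
qed

lemma sum_cis_roots_of_unity:
  assumes "K > 0"
  shows "(\<Sum>m<K. cis (2 * pi * real k * (real m / real K))) = (if K dvd k then of_nat K else 0)"
proof -
  define z where "z = cis (2 * pi * (real k / real K))"
  have pow: "cis (2 * pi * real k * (real m / real K)) = z ^ m" for m
    unfolding z_def Complex.DeMoivre by (rule arg_cong[of _ _ cis]) (simp add: mult_ac)
  show ?thesis
  proof (cases "K dvd k")
    case True
    then obtain l where "k = K * l" by blast
    hence "z = 1" using assms by (simp add: z_def)
    thus ?thesis using True by (simp only: pow) simp
  next
    case False
    have "z \<noteq> 1"
    proof
      assume "z = 1"
      hence "cos (2 * pi * (real k / real K)) = 1"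
        by (simp add: z_def complex_eq_iff)
      then obtain i :: int where "2 * pi * (real k / real K) = of_int i * 2 * pi"
        unfolding cos_one_2pi_int by blast
      hence "2 * pi * (real k / real K) = 2 * pi * of_int i"
        by simp
      hence "real k / real K = of_int i"
        unfolding mult_cancel_left by simp
      hence "real_of_int (int k) = real_of_int (i * int K)"
        using assms by (simp add: field_simps)
      hence "int k = i * int K" by (simp only: of_int_eq_iff)
      hence "int K dvd int k" by simp
      thus False using False by simp
    qed
    moreover have "z ^ K = 1"
      using assms by (simp add: z_def Complex.DeMoivre)
    ultimately show ?thesis
      using False by (simp only: pow) (simp add: geometric_sum)
  qed
qed

text \<open>
  For equal \<open>j\<close> the differences are nonzero multiples of \<open>1 / K\<close>; this is where \<open>q \<le> 1\<close> enters.
\<close>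

lemma separated_mod_1_dilate:
  assumes sep: "separated_mod_1 q I y" and "q \<le> 1" "K > 0"
  shows "separated_mod_1 (q / real K) (I \<times> {..<K}) (\<lambda>(j, m). (y j + real m) / real K)"
  unfolding separated_mod_1_def
proof (intro ballI impI allI)
  fix p p' k
  assume p: "p \<in> I \<times> {..<K}" "p' \<in> I \<times> {..<K}" "p \<noteq> p'"
  obtain j m j' m' where jm: "p = (j, m)" "p' = (j', m')" by fastforce
  define i :: int where "i = int K * k + int m' - int m"
  have "q \<le> \<bar>y j - y j' - of_int i\<bar>"
  proof (cases "j = j'")
    case False
    thus ?thesis using sep p jm by (auto simp: separated_mod_1_def)
  next
    case True
    have "i \<noteq> 0"
    proof
      assume "i = 0"
      hence "int m = int m' + int K * k" by (simp add: i_def)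
      hence "int m mod int K = int m' mod int K" by simp
      thus False using p jm True by simp
    qed
    hence "\<bar>i\<bar> \<ge> 1" by linarith
    hence "1 \<le> \<bar>real_of_int i\<bar>" by linarith
    thus ?thesis using True \<open>q \<le> 1\<close> by simp
  qed
  hence "q / real K \<le> \<bar>y j - y j' - of_int i\<bar> / real K"
    by (rule divide_right_mono) simp
  also have "\<dots> = \<bar>(y j - y j' - of_int i) / real K\<bar>"
    by simp
  also have "(y j - y j' - of_int i) / real K = (y j + real m) / real K - (y j' + real m') / real K - of_int k"
    using \<open>K > 0\<close> by (simp add: i_def field_simps)
  finally show "q / real K \<le> \<bar>(case p of (j, m) \<Rightarrow> (y j + real m) / real K) -
      (case p' of (j, m) \<Rightarrow> (y j + real m) / real K) - of_int k\<bar>"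
    by (simp add: jm)
qed

text \<open>
  Over the dilated points the sum at frequency \<open>k\<close> equals \<open>K\<close> times the original sum at \<open>k / K\<close> if
  \<open>K\<close> divides \<open>k\<close>, and 0 otherwise. The range \<open>1..K * (N + 1) - 1\<close> is the longest one that
  contains just \<open>N\<close> multiples of \<open>K\<close>.
\<close>

theorem dual_large_sieve_sharp_lower_bound:
  fixes y :: "'a \<Rightarrow> real" and c :: "'a \<Rightarrow> complex"
  assumes fin: "finite I" and "0 < q" "q \<le> 1" and sep: "separated_mod_1 q I y"
  shows "(real N + 1 - 1 / q) * (\<Sum>j\<in>I. (cmod (c j))\<^sup>2) \<le>
    (\<Sum>l=1..N. (cmod (\<Sum>j\<in>I. c j * cis (2 * pi * real l * y j)))\<^sup>2)"
proof -
  define n where "n = (\<Sum>j\<in>I. (cmod (c j))\<^sup>2)"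
  define G where "G = (\<Sum>l=1..N. (cmod (\<Sum>j\<in>I. c j * cis (2 * pi * real l * y j)))\<^sup>2)"
  have approx: "(real N + 1 - 1 / q - 1 / real K) * n \<le> G" if "K > 0" for K
  proof -
    define L where "L = K * (N + 1) - 1"
    define S where "S k = (\<Sum>j\<in>I. c j * cis (2 * pi * real k * (y j / real K)))" for k
    have L: "real L = real K * (real N + 1) - 1"
      using that by (simp add: L_def of_nat_diff algebra_simps)
    have inner: "(\<Sum>(j, m)\<in>I \<times> {..<K}. c j * cis (2 * pi * real k * ((y j + real m) / real K))) =
        (if K dvd k then of_nat K * S k else 0)" for k
    proof -
      have "(\<Sum>(j, m)\<in>I \<times> {..<K}. c j * cis (2 * pi * real k * ((y j + real m) / real K))) =
          (\<Sum>j\<in>I. \<Sum>m<K. (c j * cis (2 * pi * real k * (y j / real K))) *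
            cis (2 * pi * real k * (real m / real K)))"
        by (simp add: sum.cartesian_product mult.assoc cis_mult add_divide_distrib distrib_left)
      also have "\<dots> = S k * (\<Sum>m<K. cis (2 * pi * real k * (real m / real K)))"
        by (simp add: S_def sum_product)
      finally show ?thesis
        unfolding sum_cis_roots_of_unity[OF that] by simp
    qed
    have "(real L - 1 / (q / real K)) * (\<Sum>(j, m)\<in>I \<times> {..<K}. (cmod (c j))\<^sup>2) \<le>
        (\<Sum>k=1..L. (cmod (\<Sum>(j, m)\<in>I \<times> {..<K}. c j * cis (2 * pi * real k * ((y j + real m) / real K))))\<^sup>2)"
      using dual_large_sieve_lower_bound[OF _ _ separated_mod_1_dilate[OF sep \<open>q \<le> 1\<close> that],
          where u = "\<lambda>(j, m). c j" and L = L] fin \<open>q > 0\<close> that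
      by (simp add: case_prod_unfold)
    also have "\<dots> = (\<Sum>k=1..L. if K dvd k then (real K * cmod (S k))\<^sup>2 else 0)"
      unfolding inner by (intro sum.cong refl) (simp add: norm_mult)
    also have "\<dots> = (\<Sum>k\<in>(*) K ` {1..N}. (real K * cmod (S k))\<^sup>2)"
    proof (rule sum.mono_neutral_cong_right)
      show "(*) K ` {1..N} \<subseteq> {1..L}"
      proof
        fix k assume "k \<in> (*) K ` {1..N}"
        then obtain l where "k = K * l" "l \<in> {1..N}" by (rule imageE)
        hence l: "k = K * l" "1 \<le> l" "l \<le> N" by auto
        have "L = K * N + (K - 1)" using that by (simp add: L_def)
        hence "K * l \<le> L" using l by (simp add: trans_le_add1)
        thus "k \<in> {1..L}" using l that by simp
      qed
      show "\<forall>k\<in>{1..L} - (*) K ` {1..N}. (if K dvd k then (real K * cmod (S k))\<^sup>2 else 0) = 0"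
      proof
        fix k assume k: "k \<in> {1..L} - (*) K ` {1..N}"
        have "\<not> K dvd k"
        proof
          assume "K dvd k"
          then obtain l where l: "k = K * l" by blast
          have "K * l < K * (N + 1)" using k l that by (auto simp: L_def)
          hence "l < N + 1" by (simp only: mult_less_cancel1)
          hence "l \<le> N" by simp
          thus False using k l by (cases "l = 0") auto
        qed
        thus "(if K dvd k then (real K * cmod (S k))\<^sup>2 else 0) = 0" by simp
      qed
    qed auto
    also have "\<dots> = (\<Sum>l=1..N. (real K * cmod (S (K * l)))\<^sup>2)"
      using that by (subst sum.reindex) (auto simp: inj_on_def)
    also have "\<dots> = (real K)\<^sup>2 * G"
    proof -
      have "2 * pi * real (K * l) * (y j / real K) = 2 * pi * real l * y j" for l j
        using that by simp
      thus ?thesis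
        unfolding G_def S_def power_mult_distrib sum_distrib_left by (simp only:)
    qed
    also have "(\<Sum>(j, m)\<in>I \<times> {..<K}. (cmod (c j))\<^sup>2) = real K * n"
      by (simp add: n_def sum_distrib_left flip: sum.cartesian_product)
    also have "(real L - 1 / (q / real K)) * (real K * n) =
        (real K)\<^sup>2 * ((real N + 1 - 1 / q - 1 / real K) * n)"
      using that by (simp add: L field_simps power2_eq_square)
    finally show ?thesis using that by simp
  qed
  have "(\<lambda>K. (real N + 1 - 1 / q - 1 / real (Suc K)) * n) \<longlonglongrightarrow> (real N + 1 - 1 / q - 0) * n"
    by (intro tendsto_intros LIMSEQ_Suc[OF lim_1_over_n])
  hence "(real N + 1 - 1 / q - 0) * n \<le> G"
    by (rule LIMSEQ_le_const2) (use approx in blast)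
  thus ?thesis by (simp add: n_def G_def)
qed

section \<open>The smallest singular value\<close>

text \<open>
  An eigenvector \<open>v\<close> of $A^* A$ satisfies
  $\|A v\|^2 = \langle v, A^* A v \rangle = s^2 \|v\|^2$.
\<close>

lemma singular_value_attained:
  assumes "s \<in> singular_values A"
  obtains c :: "nat \<Rightarrow> complex" where "(\<Sum>i<dim_col A. (cmod (c i))\<^sup>2) > 0"
    "(\<Sum>r<dim_row A. (cmod (\<Sum>i<dim_col A. A $$ (r, i) * c i))\<^sup>2) =
      s\<^sup>2 * (\<Sum>i<dim_col A. (cmod (c i))\<^sup>2)"
proof -
  let ?n = "dim_row A" and ?m = "dim_col A"
  let ?B = "mat_adjoint A * A"
  have B: "?B \<in> carrier_mat ?m ?m"
    by (auto simp: mat_adjoint_def)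
  obtain v where "eigenvector ?B v (of_real (s\<^sup>2))"
    using assms by (auto simp: singular_values_def eigenvalue_def)
  hence v: "v \<in> carrier_vec ?m" "v \<noteq> 0\<^sub>v ?m" "?B *\<^sub>v v = of_real (s\<^sup>2) \<cdot>\<^sub>v v"
    using B by (auto simp: eigenvector_def)
  define c where "c i = vec_index v i" for i
  define w where "w r = (\<Sum>i<?m. A $$ (r, i) * c i)" for r
  define z where "z = A *\<^sub>v v"
  have z: "dim_vec z = ?n" "\<And>r. r < ?n \<Longrightarrow> vec_index z r = w r"
    using v(1) by (auto simp: z_def w_def c_def scalar_prod_def atLeast0LessThan)
  have eig: "of_real (s\<^sup>2) * c i = (\<Sum>r<?n. cnj (A $$ (r, i)) * w r)" if "i < ?m" for i
  proof -
    have "of_real (s\<^sup>2) * c i = vec_index (?B *\<^sub>v v) i"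
      unfolding v(3) using v(1) that by (simp add: c_def)
    also have "?B *\<^sub>v v = mat_adjoint A *\<^sub>v z"
      unfolding z_def
      by (rule assoc_mult_mat_vec[of _ ?m ?n _ ?m]) (use v in \<open>auto simp: mat_adjoint_def\<close>)
    also have "vec_index \<dots> i = (\<Sum>r<?n. cnj (A $$ (r, i)) * w r)"
      using that
      by (auto simp: mat_adjoint_def scalar_prod_def atLeast0LessThan z mat_of_rows_row)
    finally show ?thesis .
  qed
  have "complex_of_real (s\<^sup>2 * (\<Sum>i<?m. (cmod (c i))\<^sup>2)) = (\<Sum>i<?m. of_real (s\<^sup>2) * c i * cnj (c i))"
    by (simp add: sum_distrib_left complex_norm_square mult.assoc del: of_real_power)
  also have "\<dots> = (\<Sum>i<?m. \<Sum>r<?n. cnj (A $$ (r, i)) * w r * cnj (c i))"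
    by (simp add: eig sum_distrib_right del: of_real_power)
  also have "\<dots> = (\<Sum>r<?n. \<Sum>i<?m. cnj (A $$ (r, i)) * w r * cnj (c i))"
    by (rule sum.swap)
  also have "\<dots> = (\<Sum>r<?n. w r * cnj (w r))"
    by (simp add: w_def[of r for r] sum_distrib_left mult_ac)
  also have "\<dots> = complex_of_real (\<Sum>r<?n. (cmod (w r))\<^sup>2)"
    by (simp add: complex_norm_square del: of_real_power)
  finally have norm_eq: "(\<Sum>r<?n. (cmod (w r))\<^sup>2) = s\<^sup>2 * (\<Sum>i<?m. (cmod (c i))\<^sup>2)"
    by (simp only: of_real_eq_iff)
  obtain i where "i < ?m" "c i \<noteq> 0"
    using v(1,2) unfolding c_def by (metis carrier_vecD eq_vecI index_zero_vec)
  hence "(\<Sum>i<?m. (cmod (c i))\<^sup>2) > 0"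
    by (intro sum_pos2[of _ i]) auto
  thus ?thesis
    using norm_eq that unfolding w_def by blast
qed

lemma q_separated_imp_separated_mod_1:
  assumes "q_separated q M y"
  shows "separated_mod_1 q {..<M} y"
  unfolding separated_mod_1_def
proof (intro ballI impI allI)
  fix i j and k :: int
  assume "i \<in> {..<M}" "j \<in> {..<M}" "i \<noteq> j"
  hence "q \<le> wrap_dist (y i) (y j)"
    using assms by (simp add: q_separated_def)
  also have "\<dots> \<le> \<bar>y i - y j - of_int k\<bar>"
    unfolding wrap_dist_def by (rule cINF_lower) (auto intro: bdd_belowI[of _ 0])
  finally show "q \<le> \<bar>y i - y j - of_int k\<bar>" .
qed

theorem corollary4p1:
  fixes N M :: nat and q :: real and y :: "nat \<Rightarrow> real"
  assumes "M \<ge> 1"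
    and "q > 0"
    and "M = 1 \<Longrightarrow> q \<le> 1"
    and "\<And>j. j < M \<Longrightarrow> y j \<in> {0..<1}"
    and "q_separated q M y"
  shows "(sigma_min (vandermonde N M y))\<^sup>2 \<ge> real N + 1 - 1 / q"
proof -
  let ?V = "vandermonde N M y"
  have "q \<le> 1"
    using assms(1,3) q_separated_imp_le_half[OF assms(5)] by (cases "M = 1") auto
  have dim: "dim_row ?V = N" "dim_col ?V = M"
    by (simp_all add: vandermonde_def)
  have "sigma_min ?V \<in> singular_values ?V"
    unfolding sigma_min_def
    using assms(1) dim by (intro Min_in finite_singular_values singular_values_nonempty) auto
  then obtain c where c: "(\<Sum>j<M. (cmod (c j))\<^sup>2) > 0"
    "(\<Sum>k<N. (cmod (\<Sum>j<M. ?V $$ (k, j) * c j))\<^sup>2) = (sigma_min ?V)\<^sup>2 * (\<Sum>j<M. (cmod (c j))\<^sup>2)"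
    using singular_value_attained[of "sigma_min ?V" ?V] unfolding dim by blast
  \<comment> \<open>The rows of the matrix start at frequency 0, the sums above at frequency 1.\<close>
  define b where "b j = c j * cis (- (2 * pi * y j))" for j
  have entry: "?V $$ (k, j) = cis (2 * pi * real k * y j)" if "k < N" "j < M" for k j
    using that by (simp add: vandermonde_def cis_conv_exp mult_ac)
  have "(real N + 1 - 1 / q) * (\<Sum>j<M. (cmod (b j))\<^sup>2) \<le>
      (\<Sum>l=1..N. (cmod (\<Sum>j<M. b j * cis (2 * pi * real l * y j)))\<^sup>2)"
    by (rule dual_large_sieve_sharp_lower_bound)
      (use assms \<open>q \<le> 1\<close> q_separated_imp_separated_mod_1 in auto)
  also have "\<dots> = (\<Sum>k<N. (cmod (\<Sum>j<M. b j * cis (2 * pi * real (Suc k) * y j)))\<^sup>2)"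
    by (rule sum.reindex_bij_witness[of _ Suc "\<lambda>l. l - 1"]) auto
  also have "\<dots> = (\<Sum>k<N. (cmod (\<Sum>j<M. ?V $$ (k, j) * c j))\<^sup>2)"
    by (intro sum.cong refl arg_cong[of _ _ "\<lambda>z. (cmod z)\<^sup>2"])
      (simp add: entry b_def cis_mult mult.assoc distrib_left distrib_right mult.left_commute)
  finally show ?thesis
    using c by (simp add: b_def norm_mult)
qed

end
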